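(* Let $\lambda\in\mathbb{R}$ and $x\in\mathbb{R}$. For every integer $d\ge1$ and every integer $n\ge 0$, $$D_{n,\lambda}(x)=\sum_{m=0}^{n}d^{\,m-1}S_1(n,m)\sum_{a=0}^{d-1}\beta_{m,\frac{\lambda}{d}}\left(\frac{a+x}{d}\right).$$
   Context: All generating functions are formal power series in $t$. For $\lambda,y\in\mathbb{R}$, set $(y)_{0,\lambda}=1$ and $(y)_{n,\lambda}=y(y-\lambda)\cdots(y-(n-1)\lambda)$ for $n\ge1$; the formal power series $(1+\lambda u)^{y/\lambda}$ means $\sum_{n\ge0}(y)_{n,\lambda}\frac{u^n}{n!}$ (the usual binomial series for $\lambda\ne0$, and the limit $e^{yu}$ for $\lambda=0$). For any real parameter $\lambda$, the degenerate Bernoulli polynomials $\beta_{n,\lambda}(x)$ (Carlitz) are defined by $\frac{t}{(1+\lambda t)^{1/\lambda}-1}(1+\lambda t)^{x/\lambda}=\sum_{n=0}^\infty \beta_{n,\lambda}(x)\frac{t^n}{n!}$; $\beta_{m,\lambda/d}$ is the same with parameter $\lambda/d$ in place of $\lambda$. The degenerate Daehee polynomials of the second kind $D_{n,\lambda}(x)$ are defined by $\frac{\log(1+t)}{(1+\lambda\log(1+t))^{1/\lambda}-1}(1+\lambda\log(1+t))^{x/\lambda}=\sum_{n=0}^\infty D_{n,\lambda}(x)\frac{t^n}{n!}$. $S_1(n,l)$ are the (signed) Stirling numbers of the first kind: $x(x-1)\cdots(x-n+1)=\sum_{l=0}^n S_1(n,l)x^l$ (the empty product being $1$ for $n=0$).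 *)

theory Defs
  imports Complex_Main "HOL-Computational_Algebra.Computational_Algebra"
begin

(* The degenerate falling factorial (y)_{n,lam} = y (y - lam) ... (y - (n-1) lam). *)
definition deg_ffact :: "real \<Rightarrow> real \<Rightarrow> nat \<Rightarrow> real" where
  "deg_ffact lam y n = (\<Prod>i<n. (y - real i * lam))"

(* The formal power series (1 + lam u)^(y / lam); for lam = 0 it is e^(y u). *)
definition deg_exp :: "real \<Rightarrow> real \<Rightarrow> real fps" where
  "deg_exp lam y = Abs_fps (\<lambda>n. deg_ffact lam y n / fact n)"

(* Division of formal power series cancels the common factor X here: the denominator has
   subdegree 1 for every lam, see deg_exp_1_minus_1_times_quotient. *)
definition deg_bernoulli_gf :: "real \<Rightarrow> real \<Rightarrow> real fps" where
  "deg_bernoulli_gf lam x = (fps_X / (deg_exp lam 1 - 1)) * deg_exp lam x"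

definition deg_bernoulli :: "nat \<Rightarrow> real \<Rightarrow> real \<Rightarrow> real" where
  "deg_bernoulli n lam x = fact n * fps_nth (deg_bernoulli_gf lam x) n"

(* fps_ln 1 is the series of log (1 + t), which has zero constant term, so the composition
   deg_exp lam y oo fps_ln 1 is (1 + lam log (1 + t))^(y / lam). *)
definition deg_daehee_gf :: "real \<Rightarrow> real \<Rightarrow> real fps" where
  "deg_daehee_gf lam x =
     (fps_ln 1 / ((deg_exp lam 1 oo fps_ln 1) - 1)) * (deg_exp lam x oo fps_ln 1)"

definition deg_daehee :: "nat \<Rightarrow> real \<Rightarrow> real \<Rightarrow> real" where
  "deg_daehee n lam x = fact n * fps_nth (deg_daehee_gf lam x) n"

(* Signed, unlike the library's stirling. *)
definition stirling1 :: "nat \<Rightarrow> nat \<Rightarrow> real" where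
  "stirling1 n l = coeff (\<Prod>i<n. [:- real i, 1:]) l"

lemma deg_bernoulli_gf_eq: "Abs_fps (\<lambda>n. deg_bernoulli n lam x / fact n) = deg_bernoulli_gf lam x"
  by (rule fps_ext) (simp add: deg_bernoulli_def)

lemma deg_daehee_gf_eq: "Abs_fps (\<lambda>n. deg_daehee n lam x / fact n) = deg_daehee_gf lam x"
  by (rule fps_ext) (simp add: deg_daehee_def)

lemma subdegree_deg_exp_1_minus_1: "subdegree (deg_exp lam 1 - 1) = 1"
  by (rule subdegreeI) (simp_all add: deg_exp_def deg_ffact_def)

lemma deg_exp_1_minus_1_times_quotient:
  "(deg_exp lam 1 - 1) * (fps_X / (deg_exp lam 1 - 1)) = fps_X"
proof -
  have ne: "deg_exp lam 1 - 1 \<noteq> 0"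
    using subdegree_deg_exp_1_minus_1[of lam] by (metis subdegree_0 zero_neq_one)
  have "deg_exp lam 1 - 1 dvd fps_X"
    using ne subdegree_deg_exp_1_minus_1[of lam] by (simp add: fps_dvd_iff)
  then show ?thesis by simp
qed

lemma subdegree_deg_exp_1_ln_minus_1:
  "subdegree ((deg_exp lam 1 oo fps_ln 1) - 1) = 1"
  by (rule subdegreeI) (simp_all add: fps_compose_nth deg_exp_def deg_ffact_def fps_ln_def)

lemma deg_exp_1_ln_minus_1_times_quotient:
  "((deg_exp lam 1 oo fps_ln 1) - 1) * (fps_ln 1 / ((deg_exp lam 1 oo fps_ln 1) - 1)) = fps_ln 1"
proof -
  let ?g = "(deg_exp lam 1 oo fps_ln 1) - 1"
  have ne: "?g \<noteq> 0"
    using subdegree_deg_exp_1_ln_minus_1[of lam] by (metis subdegree_0 zero_neq_one)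
  have sl: "subdegree (fps_ln 1 :: real fps) = 1"
    by (rule subdegreeI) (simp_all add: fps_ln_def)
  then have "fps_ln 1 \<noteq> (0 :: real fps)" by (metis subdegree_0 zero_neq_one)
  then have "?g dvd fps_ln 1"
    using ne sl subdegree_deg_exp_1_ln_minus_1[of lam] by (simp add: fps_dvd_iff)
  then show ?thesis by simp
qed

lemma stirling1_sum: "(\<Prod>i<n. (x - real i)) = (\<Sum>l=0..n. stirling1 n l * x ^ l)"
proof -
  let ?p = "\<Prod>i<n. [:- real i, 1:]"
  have "degree ?p = n"
    by (subst degree_prod_eq_sum_degree) auto
  then have "poly ?p x = (\<Sum>l\<le>n. coeff ?p l * x ^ l)"
    by (simp add: poly_altdef)
  then show ?thesis
    by (simp add: poly_prod stirling1_def atMost_atLeast0)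
qed

lemma deg_exp_0: "deg_exp 0 y = fps_exp y"
  by (rule fps_ext) (simp add: deg_exp_def deg_ffact_def)

end

theory Submission
  imports Defs
begin

text \<open>
  The generating function of the Daehee polynomials is that of the Bernoulli polynomials composed
  with \<open>log (1 + t)\<close>, and the coefficients of \<open>log (1 + t) ^ m / m!\<close> are Stirling numbers, so
  \<open>D\<^sub>n(x) = (\<Sum>m\<le>n. S\<^sub>1(n,m) \<beta>\<^sub>m(x))\<close>. It remains to apply Raabe's multiplication formula: substituting
  \<open>d t\<close> for \<open>t\<close> turns the parameter \<open>\<lambda>/d\<close> into \<open>\<lambda>\<close> and the argument \<open>y/d\<close> into \<open>y\<close>, and the sum over
  \<open>a\<close> is then geometric in \<open>(1 + \<lambda> t) ^ (1/\<lambda>)\<close>.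
\<close>

lemma deg_exp_nth_0 [simp]: "deg_exp lam y $ 0 = 1"
  by (simp add: deg_exp_def deg_ffact_def)

lemma deg_exp_zero: "deg_exp lam 0 = 1"
  \<comment> \<open>For positive degree the product vanishes through its factor of index
    \<open>0\<close>.\<close>
  by (rule fps_ext) (auto simp: deg_exp_def deg_ffact_def intro!: bexI[of _ 0])

lemma deg_exp_nth_Suc:
  "of_nat (Suc n) * deg_exp lam y $ Suc n = (y - real n * lam) * deg_exp lam y $ n"
  by (simp add: deg_exp_def deg_ffact_def field_simps del: of_nat_Suc)

lemma deg_exp_deriv:
  "(1 + fps_const lam * fps_X) * fps_deriv (deg_exp lam y) = fps_const y * deg_exp lam y"
proof (rule fps_ext)
  fix n
  show "((1 + fps_const lam * fps_X) * fps_deriv (deg_exp lam y)) $ n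
      = (fps_const y * deg_exp lam y) $ n"
    using deg_exp_nth_Suc[of n lam y]
    by (cases n) (simp_all add: distrib_right mult.assoc algebra_simps)
qed

text \<open>Comparing coefficients in the differential equation gives the recurrence of
  \<open>deg_exp_nth_Suc\<close>, which fixes each coefficient by the preceding one.\<close>

lemma deg_exp_unique:
  assumes ode: "(1 + fps_const lam * fps_X) * fps_deriv f = fps_const y * f"
    and init: "f $ 0 = 1"
  shows "f = deg_exp lam y"
proof (rule fps_ext)
  fix n
  show "f $ n = deg_exp lam y $ n"
  proof (induction n)
    case 0
    show ?case by (simp add: init)
  next
    case (Suc n)
    have "((1 + fps_const lam * fps_X) * fps_deriv f) $ n = (fps_const y * f) $ n"
      by (simp only: ode)
    then have "of_nat (Suc n) * f $ Suc n = (y - real n * lam) * f $ n"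
      by (cases n) (simp_all add: distrib_right mult.assoc algebra_simps)
    also have "\<dots> = of_nat (Suc n) * deg_exp lam y $ Suc n"
      by (simp only: deg_exp_nth_Suc Suc.IH)
    finally show ?case
      by (simp del: of_nat_Suc)
  qed
qed

text \<open>By the Leibniz rule the product solves the differential equation with constant
  \<open>x + y\<close>.\<close>

lemma deg_exp_add: "deg_exp lam (x + y) = deg_exp lam x * deg_exp lam y"
proof (rule deg_exp_unique[symmetric])
  have "(1 + fps_const lam * fps_X) * fps_deriv (deg_exp lam x * deg_exp lam y)
      = deg_exp lam x * ((1 + fps_const lam * fps_X) * fps_deriv (deg_exp lam y))
        + ((1 + fps_const lam * fps_X) * fps_deriv (deg_exp lam x)) * deg_exp lam y"
    by (simp add: algebra_simps)
  also have "\<dots> = (fps_const x + fps_const y) * (deg_exp lam x * deg_exp lam y)"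
    by (simp only: deg_exp_deriv) (simp add: algebra_simps del: fps_const_add)
  finally show "(1 + fps_const lam * fps_X) * fps_deriv (deg_exp lam x * deg_exp lam y)
      = fps_const (x + y) * (deg_exp lam x * deg_exp lam y)"
    by simp
qed simp

lemma deg_exp_of_nat: "deg_exp lam (real n) = deg_exp lam 1 ^ n"
  by (induction n) (simp_all add: deg_exp_zero deg_exp_add)

text \<open>The substitution contributes \<open>c ^ n\<close> in degree \<open>n\<close>, one
  \<open>c\<close> for each of the \<open>n\<close> factors of the falling factorial.\<close>

lemma deg_exp_rescale:
  assumes "c \<noteq> 0"
  shows "deg_exp (lam / c) (y / c) oo (fps_const c * fps_X) = deg_exp lam y"
proof (rule fps_ext)
  fix n
  have "c ^ n * deg_ffact (lam / c) (y / c) n = (\<Prod>i<n. c * (y / c - real i * (lam / c)))"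
    by (simp add: deg_ffact_def prod.distrib)
  also have "\<dots> = deg_ffact lam y n"
    unfolding deg_ffact_def by (rule prod.cong) (use assms in \<open>auto simp: field_simps\<close>)
  finally show "(deg_exp (lam / c) (y / c) oo (fps_const c * fps_X)) $ n = deg_exp lam y $ n"
    by (simp add: fps_nth_compose_linear deg_exp_def)
qed

lemma deg_bernoulli_gf_times:
  "(deg_exp lam 1 - 1) * deg_bernoulli_gf lam x = fps_X * deg_exp lam x"
  unfolding deg_bernoulli_gf_def mult.assoc[symmetric] deg_exp_1_minus_1_times_quotient ..

lemma deg_bernoulli_gf_raabe:
  assumes "d \<ge> 1"
  shows "(\<Sum>a<d. deg_bernoulli_gf (lam / real d) ((real a + x) / real d)
              oo (fps_const (real d) * fps_X))
       = fps_const (real d) * deg_bernoulli_gf lam x"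
proof -
  let ?E = "deg_exp lam 1" and ?s = "fps_const (real d) * fps_X :: real fps"
  have d: "real d \<noteq> 0" using assms by simp
  \<comment> \<open>After the substitution the denominator is \<open>?E ^ d - 1\<close> whatever
    \<open>y\<close> is, so all summands share it and it can be cleared at once.\<close>
  have B: "(?E ^ d - 1) * (deg_bernoulli_gf (lam / real d) (y / real d) oo ?s)
      = ?s * deg_exp lam y" for y
  proof -
    have "((deg_exp (lam / real d) 1 - 1) * deg_bernoulli_gf (lam / real d) (y / real d)) oo ?s
        = (fps_X * deg_exp (lam / real d) (y / real d)) oo ?s"
      by (simp only: deg_bernoulli_gf_times)
    moreover have "deg_exp (lam / real d) 1 oo ?s = ?E ^ d"
      using deg_exp_rescale[OF d, of lam "real d"] d by (simp add: deg_exp_of_nat)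
    ultimately show ?thesis
      by (simp add: fps_compose_mult_distrib fps_compose_sub_distrib deg_exp_rescale[OF d])
  qed
  have "?E ^ d - 1 = (?E - 1) * (\<Sum>a<d. ?E ^ a)"
    by (rule power_diff_1_eq)
  moreover have "?E ^ d - 1 \<noteq> 0"
  proof
    assume "?E ^ d - 1 = 0"
    \<comment> \<open>At \<open>y = 0\<close> the right-hand side of \<open>B\<close> is the nonzero
      series \<open>?s\<close>.\<close>
    then have "?s * deg_exp lam 0 = 0" using B[of 0] by simp
    then show False using d by (simp add: deg_exp_zero)
  qed
  moreover have "(?E ^ d - 1) * (\<Sum>a<d. deg_bernoulli_gf (lam / real d) ((real a + x) / real d) oo ?s)
      = (?E ^ d - 1) * (fps_const (real d) * deg_bernoulli_gf lam x)"
  proof -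
    have "(?E ^ d - 1) * (\<Sum>a<d. deg_bernoulli_gf (lam / real d) ((real a + x) / real d) oo ?s)
        = (\<Sum>a<d. ?s * deg_exp lam (real a + x))"
      by (simp only: sum_distrib_left B)
    also have "\<dots> = fps_const (real d) * (\<Sum>a<d. ?E ^ a) * (fps_X * deg_exp lam x)"
      by (simp add: deg_exp_add deg_exp_of_nat sum_distrib_left sum_distrib_right mult_ac)
    \<comment> \<open>Here \<open>fps_X * deg_exp lam x\<close> supplies the factor
      \<open>?E - 1\<close> that completes the geometric sum to \<open>?E ^ d - 1\<close>.\<close>
    also have "\<dots> = (?E ^ d - 1) * (fps_const (real d) * deg_bernoulli_gf lam x)"
      by (simp only: deg_bernoulli_gf_times[symmetric] power_diff_1_eq mult_ac)
    finally show ?thesis .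
  qed
  ultimately show ?thesis by (metis mult_cancel_left)
qed

text \<open>Coefficients of degree \<open>m\<close> are compared: the substitution gives
  \<open>d ^ m\<close> and the right-hand side a factor \<open>d\<close>. At \<open>m = 0\<close>
  the exponent is -1, hence \<open>powi\<close>.\<close>

lemma deg_bernoulli_raabe:
  assumes "d \<ge> 1"
  shows "real d powi (int m - 1)
           * (\<Sum>a<d. deg_bernoulli m (lam / real d) ((real a + x) / real d))
       = deg_bernoulli m lam x"
proof -
  have d: "real d \<noteq> 0" using assms by simp
  have "(\<Sum>a<d. deg_bernoulli_gf (lam / real d) ((real a + x) / real d)
              oo (fps_const (real d) * fps_X)) $ m
       = (fps_const (real d) * deg_bernoulli_gf lam x) $ m"
    by (simp only: deg_bernoulli_gf_raabe[OF assms])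
  then have "real d ^ m * (\<Sum>a<d. deg_bernoulli m (lam / real d) ((real a + x) / real d))
      = real d * deg_bernoulli m lam x"
    by (simp add: fps_sum_nth fps_nth_compose_linear deg_bernoulli_def sum_distrib_left[symmetric]
        mult.left_commute)
  then show ?thesis
    using d by (simp add: power_int_diff field_simps)
qed

lemma stirling1_0: "stirling1 0 m = (if m = 0 then 1 else 0)"
  by (simp add: stirling1_def coeff_1)

lemma stirling1_Suc:
  "stirling1 (Suc n) m = (case m of 0 \<Rightarrow> 0 | Suc k \<Rightarrow> stirling1 n k) - real n * stirling1 n m"
  by (simp add: stirling1_def mult.commute[of _ "[:- real n, 1:]"] coeff_pCons split: nat.split)

text \<open>This is the chain rule with derivative \<open>1 / (1 + t)\<close> of the logarithm. At
  \<open>m = 0\<close> the truncated exponent is harmless, as both sides vanish.\<close>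

lemma fps_ln_power_deriv:
  "(1 + fps_X) * fps_deriv (fps_ln 1 ^ m) = of_nat m * (fps_ln 1 ^ (m - 1) :: real fps)"
proof -
  have "(1 + fps_X) * fps_deriv (fps_ln 1 :: real fps) = 1"
    by (simp add: fps_ln_deriv inverse_mult_eq_1')
  then show ?thesis
    by (simp add: fps_deriv_power mult.left_commute[of "1 + fps_X"] mult.commute[of _ "1 + fps_X"]
        fps_of_nat[symmetric])
qed

text \<open>Taking coefficients in \<open>fps_ln_power_deriv\<close> yields, after scaling by
  factorials, the recurrence \<open>stirling1_Suc\<close>.\<close>

lemma fps_ln_power_nth: "(fps_ln 1 ^ m) $ n = fact m / fact n * stirling1 n m"
proof (induction n arbitrary: m)
  case 0
  show ?case by (cases m) (simp_all add: stirling1_0)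
next
  case (Suc n)
  have "((1 + fps_X) * fps_deriv (fps_ln 1 ^ m :: real fps)) $ n
      = (of_nat m * fps_ln 1 ^ (m - 1)) $ n"
    by (simp only: fps_ln_power_deriv)
  then have "of_nat (Suc n) * (fps_ln 1 ^ m) $ Suc n + of_nat n * (fps_ln 1 ^ m) $ n
      = of_nat m * (fps_ln 1 ^ (m - 1) :: real fps) $ n"
    by (cases n) (simp_all add: distrib_right fps_of_nat[symmetric])
  then have "fact n * real (Suc n) * (fps_ln 1 ^ m) $ Suc n
      = real m * fact (m - 1) * stirling1 n (m - 1) - real n * fact m * stirling1 n m"
    by (simp add: Suc.IH field_simps)
  also have "\<dots> = fact m * stirling1 (Suc n) m"
    by (cases m) (simp_all add: stirling1_Suc algebra_simps)
  finally show ?case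
    by (simp add: eq_divide_eq mult_ac del: of_nat_Suc)
qed

text \<open>Instead of composing a quotient, both sides are multiplied by the denominator
  \<open>?g\<close>, which is nonzero because its subdegree is 1.\<close>

lemma deg_daehee_gf_eq_compose: "deg_daehee_gf lam x = deg_bernoulli_gf lam x oo fps_ln 1"
proof -
  let ?g = "(deg_exp lam 1 oo fps_ln 1) - 1"
  have "?g * deg_daehee_gf lam x = fps_ln 1 * (deg_exp lam x oo fps_ln 1)"
    unfolding deg_daehee_gf_def mult.assoc[symmetric] deg_exp_1_ln_minus_1_times_quotient ..
  also have "\<dots> = (fps_X * deg_exp lam x) oo fps_ln 1"
    by (simp add: fps_compose_mult_distrib)
  also have "\<dots> = ((deg_exp lam 1 - 1) * deg_bernoulli_gf lam x) oo fps_ln 1"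
    by (simp only: deg_bernoulli_gf_times)
  also have "\<dots> = ?g * (deg_bernoulli_gf lam x oo fps_ln 1)"
    by (simp add: fps_compose_mult_distrib fps_compose_sub_distrib)
  finally show ?thesis
    using subdegree_deg_exp_1_ln_minus_1[of lam] by auto
qed

lemma deg_daehee_eq_stirling1_sum:
  "deg_daehee n lam x = (\<Sum>m=0..n. stirling1 n m * deg_bernoulli m lam x)"
  by (simp add: deg_daehee_def deg_daehee_gf_eq_compose fps_compose_nth fps_ln_power_nth
      deg_bernoulli_def sum_distrib_left mult_ac)

theorem theorem2p5:
  fixes lam x :: real and d n :: nat
  assumes "d \<ge> 1"
  shows "deg_daehee n lam x =
    (\<Sum>m=0..n. real d powi (int m - 1) * stirling1 n m *
       (\<Sum>a=0..d - 1. deg_bernoulli m (lam / real d) ((real a + x) / real d)))"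
proof -
  \<comment> \<open>The subtraction is on naturals, so \<open>d \<ge> 1\<close> is used
    here.\<close>
  have "{0..d - 1} = {..<d}" using assms by auto
  then have "real d powi (int m - 1) * stirling1 n m *
       (\<Sum>a=0..d - 1. deg_bernoulli m (lam / real d) ((real a + x) / real d))
      = stirling1 n m * deg_bernoulli m lam x" for m
    by (simp only: deg_bernoulli_raabe[OF assms, of m lam x, symmetric] mult_ac)
  then show ?thesis
    by (simp only: deg_daehee_eq_stirling1_sum)
qed

end
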